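(* Let $f,g:[0,b]\to[0,b]$ be continuous unimodal Allee maps with fixed points $0<A_f<K_f$ and $0<A_g<K_g$, with maxima $M_f=f(B_f)$ and $M_g=g(B_g)$ attained at $B_f$ and $B_g$ respectively, and with $b=\max(M_f,M_g)$. Let $p\in(0,1)$, and let $\{X_n\}_{n=0}^\infty$ be the random dynamical system with $X_0=x_0\in[0,b]$ in which $X_{n+1}=f(X_n)$ with probability $p$ and $X_{n+1}=g(X_n)$ with probability $1-p$, the choices being independent over $n$. Let $A_g<A_f$, let $f$ be differentiable and $|f'(x)|<1$ for every $x\in(B_f,M_f)$. Assume that there exist functions $h_1,h_2,\ldots,h_m\in\{f,g\}$ for which $h_1\circ h_2\circ\cdots\circ h_m(K_f)<A_f$. If, in addition, $f(g(A_f))\neq A_f$, then $P(\lim_{n\to\infty}X_n=0)=1$ for every $x_0\in[0,b]$.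
   Context: A function $f:[0,b]\to[0,b]$ is called an Allee map if: it has exactly three fixed points, namely $0$, which is a stable fixed point, an unstable fixed point (threshold) $A_f>0$, and a fixed point $K_f>A_f$ (which may or may not be stable); $f(x)<x$ for all $x\in(0,A_f)\cup(K_f,b]$; and $f(x)>x$ for all $x\in(A_f,K_f)$. A continuous Allee map $f$ is unimodal if there exists $B_f\in(A_f,K_f)$ such that $f$ is strictly increasing on $(0,B_f)$ and strictly decreasing on $(B_f,b)$; $M_f=f(B_f)$ denotes its maximum. The notation $A_g,K_g,B_g,M_g$ is the analogous one for $g$. Formally, $X_{n+1}=H_n(X_n)$, where the $H_n$ are i.i.d. random functions with $P(H_n=f)=p$ and $P(H_n=g)=1-p$; $x_0$ is deterministic. *)

theory Defs
  imports "HOL-Probability.Probability"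
begin

text \<open>
  A self-map of a subset \<open>S\<close> of the line is represented by a total function on the reals, of which
  only the values on \<open>S\<close> matter. Stability is Lyapunov stability relative to \<open>S\<close>, and an unstable
  fixed point is one that is not stable.
\<close>

definition stable_fixed_point :: "real set \<Rightarrow> (real \<Rightarrow> real) \<Rightarrow> real \<Rightarrow> bool" where
  "stable_fixed_point S f c \<longleftrightarrow> c \<in> S \<and> f c = c \<and>
     (\<forall>\<epsilon>>0. \<exists>\<delta>>0. \<forall>x\<in>S. dist x c < \<delta> \<longrightarrow> (\<forall>n. dist ((f ^^ n) x) c < \<epsilon>))"

definition unstable_fixed_point :: "real set \<Rightarrow> (real \<Rightarrow> real) \<Rightarrow> real \<Rightarrow> bool" where
  "unstable_fixed_point S f c \<longleftrightarrow> c \<in> S \<and> f c = c \<and> \<not> stable_fixed_point S f c"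

definition allee_map :: "real \<Rightarrow> (real \<Rightarrow> real) \<Rightarrow> real \<Rightarrow> real \<Rightarrow> bool" where
  "allee_map b f A K \<longleftrightarrow>
     f \<in> {0..b} \<rightarrow> {0..b} \<and>
     0 < A \<and> A < K \<and>
     {x \<in> {0..b}. f x = x} = {0, A, K} \<and>
     stable_fixed_point {0..b} f 0 \<and>
     unstable_fixed_point {0..b} f A \<and>
     (\<forall>x \<in> {0<..<A} \<union> {K<..b}. f x < x) \<and>
     (\<forall>x \<in> {A<..<K}. f x > x)"

text \<open>
  The parameters \<open>A\<close>, \<open>B\<close>, \<open>K\<close> are uniquely determined by \<open>b\<close> and the map; by continuity the
  maximum of \<open>f\<close> on \<open>[0, b]\<close> is \<open>f B\<close>.
\<close>

definition unimodal_allee_map ::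
    "real \<Rightarrow> (real \<Rightarrow> real) \<Rightarrow> real \<Rightarrow> real \<Rightarrow> real \<Rightarrow> bool" where
  "unimodal_allee_map b f A B K \<longleftrightarrow>
     allee_map b f A K \<and> continuous_on {0..b} f \<and>
     B \<in> {A<..<K} \<and>
     strict_mono_on {0<..<B} f \<and> strict_antimono_on {B<..<b} f"

primrec random_orbit :: "(nat \<Rightarrow> 'w \<Rightarrow> real \<Rightarrow> real) \<Rightarrow> real \<Rightarrow> nat \<Rightarrow> 'w \<Rightarrow> real" where
  "random_orbit H x0 0 \<omega> = x0"
| "random_orbit H x0 (Suc n) \<omega> = H n \<omega> (random_orbit H x0 n \<omega>)"

text \<open>
  The i.i.d. choices: measurability into \<open>count_space {f, g}\<close>, which is part of \<open>indep_vars\<close>,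
  says that every \<open>H n\<close> takes values in \<open>{f, g}\<close> only.
\<close>

definition iid_choices ::
    "'w measure \<Rightarrow> (nat \<Rightarrow> 'w \<Rightarrow> real \<Rightarrow> real) \<Rightarrow> (real \<Rightarrow> real) \<Rightarrow> (real \<Rightarrow> real) \<Rightarrow> real \<Rightarrow> bool" where
  "iid_choices M H f g p \<longleftrightarrow>
     prob_space.indep_vars M (\<lambda>_. count_space {f, g}) H UNIV \<and>
     (\<forall>n. measure M {\<omega> \<in> space M. H n \<omega> = f} = p) \<and>
     (\<forall>n. measure M {\<omega> \<in> space M. H n \<omega> = g} = 1 - p)"

end

theory Submission
  imports Defs
begin

text \<open>
  Below \<open>Ag\<close> both maps lie below the diagonal, so an orbit that enters \<open>[0, Ag)\<close> decreases
  to \<open>0\<close>. From every starting point some finite word in \<open>f\<close> and \<open>g\<close> leads there: iterating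
  \<open>f\<close> takes points below \<open>Af\<close> below \<open>Ag\<close>, and, since \<open>f\<close> contracts towards \<open>Kf\<close>, takes points
  of \<open>(Af, Mf]\<close> close to \<open>Kf\<close>, where the given word applies by continuity; the point \<open>Af\<close>
  itself escapes through \<open>g\<close>, because \<open>f (g Af) \<noteq> Af\<close>. By compactness the length of the
  word can be chosen uniformly, so the probability of avoiding \<open>[0, Ag)\<close> decays geometrically.
\<close>

section \<open>Leaving compact sets and reaching targets\<close>

text \<open>By compactness \<open>V\<close> drops by at least some \<open>\<delta> > 0\<close> at
  every step in \<open>C\<close>, so an orbit that never left would push \<open>V\<close> below its
  minimum. Returning the exit step itself lets later arguments control where the orbit
  lands.\<close>

lemma orbit_leaves_compact:
  fixes F :: "'a::topological_space \<Rightarrow> 'a" and V :: "'a \<Rightarrow> real"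
  assumes C: "compact C" and x: "x \<in> C"
    and V: "continuous_on C V" and VF: "continuous_on C (\<lambda>y. V (F y))"
    and drop: "\<And>y. y \<in> C \<Longrightarrow> V (F y) < V y"
  obtains n where "(F ^^ n) x \<in> C" and "F ((F ^^ n) x) \<notin> C"
proof -
  have "\<exists>n. (F ^^ n) x \<in> C \<and> F ((F ^^ n) x) \<notin> C"
  proof (rule ccontr)
    assume "\<nexists>n. (F ^^ n) x \<in> C \<and> F ((F ^^ n) x) \<notin> C"
    then have inC: "(F ^^ n) x \<in> C" for n
      using x by (induction n) auto
    have "continuous_on C (\<lambda>y. V y - V (F y))"
      by (intro continuous_intros V VF)
    then obtain c where c: "c \<in> C" "\<And>y. y \<in> C \<Longrightarrow> V c - V (F c) \<le> V y - V (F y)"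
      using continuous_attains_inf[OF C] x by blast
    define \<delta> where "\<delta> = V c - V (F c)"
    have "\<delta> > 0" using drop[OF c(1)] by (simp add: \<delta>_def)
    obtain l where l: "l \<in> C" "\<And>y. y \<in> C \<Longrightarrow> V l \<le> V y"
      using continuous_attains_inf[OF C _ V] x by blast
    have "V ((F ^^ n) x) \<le> V x - n * \<delta>" for n
    proof (induction n)
      case (Suc n)
      have "\<delta> \<le> V ((F ^^ n) x) - V (F ((F ^^ n) x))"
        unfolding \<delta>_def by (rule c(2)[OF inC])
      then show ?case using Suc by (simp add: algebra_simps)
    qed simp
    then have "n * \<delta> \<le> V x - V l" for n :: nat
      using l(2)[OF inC[of n]] by (smt (verit))
    moreover obtain n :: nat where "V x - V l < n * \<delta>"
      using reals_Archimedean3[OF \<open>\<delta> > 0\<close>] by blast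
    ultimately show False by (meson not_le)
  qed
  then show ?thesis using that by blast
qed

text \<open>The points that some word of exactly \<open>n\<close> letters sends into
  \<open>S\<close>; the exact length matches a number of random steps.\<close>

primrec reach :: "('a \<Rightarrow> 'a) \<Rightarrow> ('a \<Rightarrow> 'a) \<Rightarrow> 'a set \<Rightarrow> nat \<Rightarrow> 'a set" where
  "reach f g S 0 = S"
| "reach f g S (Suc n) = f -` reach f g S n \<union> g -` reach f g S n"

text \<open>A word that has reached \<open>S\<close> can be padded with further applications of
  \<open>f\<close>, which stay in \<open>S\<close>.\<close>

lemma reach_mono:
  assumes "f \<in> S \<rightarrow> S" and "m \<le> n"
  shows "reach f g S m \<subseteq> reach f g S n"
proof -
  have "reach f g S n \<subseteq> reach f g S (Suc n)" for n
    using assms(1) by (induction n) auto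
  then show ?thesis using assms(2) by (rule lift_Suc_mono_le)
qed

lemma reach_step:
  assumes "h \<in> {f, g}" and "h x \<in> (\<Union>n. reach f g S n)"
  shows "x \<in> (\<Union>n. reach f g S n)"
proof -
  obtain n where "h x \<in> reach f g S n" using assms(2) by blast
  then have "x \<in> reach f g S (Suc n)" using assms(1) by auto
  then show ?thesis by blast
qed

lemma reach_funpow:
  "(f ^^ n) x \<in> (\<Union>n. reach f g S n) \<Longrightarrow> x \<in> (\<Union>n. reach f g S n)"
proof (induction n)
  case (Suc n)
  then show ?case using reach_step[of f f g "(f ^^ n) x"] by simp
qed simp

lemma reach_word:
  assumes "set hs \<subseteq> {f, g}" and "foldr (\<circ>) hs id x \<in> (\<Union>n. reach f g S n)"
  shows "x \<in> (\<Union>n. reach f g S n)"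
  using assms
proof (induction hs)
  case (Cons h hs)
  have "foldr (\<circ>) (h # hs) id x = h (foldr (\<circ>) hs id x)" by (simp add: comp_def)
  then have "h (foldr (\<circ>) hs id x) \<in> (\<Union>n. reach f g S n)"
    using Cons.prems(2) by metis
  moreover have "h \<in> {f, g}" "set hs \<subseteq> {f, g}" using Cons.prems(1) by simp_all
  ultimately show ?case using Cons.IH reach_step by metis
qed simp

text \<open>Openness is relative to \<open>D\<close> because continuity is known only there; each
  stage is a union of two preimages of the previous one.\<close>

lemma openin_reach:
  assumes f: "continuous_on D f" "f \<in> D \<rightarrow> D" and g: "continuous_on D g" "g \<in> D \<rightarrow> D"
    and S: "openin (top_of_set D) (D \<inter> S)"
  shows "openin (top_of_set D) (D \<inter> reach f g S n)"
proof (induction n)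
  case 0
  then show ?case using S by simp
next
  case (Suc n)
  \<comment> \<open>Invariance of \<open>D\<close> permits intersecting with \<open>D\<close> before
    taking preimages.\<close>
  have "D \<inter> reach f g S (Suc n) =
      (D \<inter> f -` (D \<inter> reach f g S n)) \<union> (D \<inter> g -` (D \<inter> reach f g S n))"
    using f g by auto
  then show ?case
    using continuous_openin_preimage[OF f Suc] continuous_openin_preimage[OF g Suc] by auto
qed

text \<open>Finitely many stages cover the compact \<open>D\<close>, and since the stages increase,
  the largest of them suffices.\<close>

lemma uniform_reach:
  assumes "compact D"
    and f: "continuous_on D f" "f \<in> D \<rightarrow> D" and g: "continuous_on D g" "g \<in> D \<rightarrow> D"
    and S: "openin (top_of_set D) (D \<inter> S)" "f \<in> S \<rightarrow> S"
    and D: "D \<subseteq> (\<Union>n. reach f g S n)"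
  obtains N where "D \<subseteq> reach f g S N"
proof -
  let ?\<C> = "range (\<lambda>n. D \<inter> reach f g S n)"
  have "\<forall>c\<in>?\<C>. openin (top_of_set D) c" and "D \<subseteq> \<Union>?\<C>"
    using openin_reach[OF f g S(1)] D by blast+
  then obtain \<D> where \<D>: "\<D> \<subseteq> ?\<C>" "finite \<D>" "D \<subseteq> \<Union>\<D>"
    using \<open>compact D\<close> unfolding compact_eq_openin_cover by metis
  obtain I where I: "finite I" "\<D> = (\<lambda>n. D \<inter> reach f g S n) ` I"
    using finite_subset_image[OF \<D>(2,1)] by blast
  \<comment> \<open>If \<open>I\<close> is empty then so is \<open>D\<close>, so the unspecified
    value of \<open>Max {}\<close> does no harm.\<close>
  have "D \<subseteq> reach f g S (Max I)"
  proof
    fix x assume "x \<in> D"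
    then obtain i where "i \<in> I" "x \<in> reach f g S i" using \<D>(3) I(2) by blast
    then show "x \<in> reach f g S (Max I)"
      using reach_mono[OF S(2), of i "Max I"] I(1) by auto
  qed
  then show ?thesis by (rule that)
qed

section \<open>Independent choices between two maps\<close>

text \<open>First-step equations for the probability of being outside \<open>S\<close> at time
  \<open>n\<close>. As a plain recursion it can be estimated before any probability space
  enters.\<close>

primrec miss_prob ::
    "real \<Rightarrow> ('a \<Rightarrow> 'a) \<Rightarrow> ('a \<Rightarrow> 'a) \<Rightarrow> 'a set \<Rightarrow> nat \<Rightarrow> 'a \<Rightarrow> real" where
  "miss_prob p f g S 0 x = indicator (- S) x"
| "miss_prob p f g S (Suc n) x =
     p * miss_prob p f g S n (f x) + (1 - p) * miss_prob p f g S n (g x)"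

lemma miss_prob_bounds:
  assumes "0 \<le> p" "p \<le> 1"
  shows "0 \<le> miss_prob p f g S n x" and "miss_prob p f g S n x \<le> 1"
proof (induction n arbitrary: x)
  case (Suc n)
  { case 1 then show ?case using Suc(1) assms by simp }
  { case 2 then show ?case using convex_bound_le[OF Suc(2) Suc(2), of p "1 - p"] assms by simp }
qed (auto simp: indicator_def)

lemma miss_prob_absorbed:
  assumes "f \<in> S \<rightarrow> S" "g \<in> S \<rightarrow> S" "x \<in> S"
  shows "miss_prob p f g S n x = 0"
  using assms(3)
proof (induction n arbitrary: x)
  case (Suc n)
  then have "f x \<in> S" "g x \<in> S" using assms(1,2) by auto
  then show ?case using Suc.IH by simp
qed simp

text \<open>Some word of \<open>n\<close> letters leads into \<open>S\<close>, and each letter is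
  drawn with probability at least \<open>min p (1 - p)\<close>.\<close>

lemma miss_prob_reach:
  assumes p: "0 < p" "p < 1" and "x \<in> reach f g S n"
  shows "miss_prob p f g S n x \<le> 1 - min p (1 - p) ^ n"
  using assms(3)
proof (induction n arbitrary: x)
  case (Suc n)
  let ?r = "min p (1 - p)"
  have nn: "0 \<le> ?r ^ n" using p by simp
  have le1: "miss_prob p f g S n y \<le> 1" for y
    using p by (intro miss_prob_bounds) auto
  consider "f x \<in> reach f g S n" | "g x \<in> reach f g S n" using Suc.prems by auto
  then show ?case
  proof cases
    case 1
    have "miss_prob p f g S (Suc n) x \<le> p * (1 - ?r ^ n) + (1 - p) * 1"
      unfolding miss_prob.simps
      using Suc.IH[OF 1] le1 p by (intro add_mono mult_left_mono) auto
    also have "\<dots> = 1 - p * ?r ^ n" by (simp add: algebra_simps)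
    also have "\<dots> \<le> 1 - ?r * ?r ^ n" using mult_right_mono[OF min.cobounded1 nn] by simp
    finally show ?thesis by simp
  next
    case 2
    have "miss_prob p f g S (Suc n) x \<le> p * 1 + (1 - p) * (1 - ?r ^ n)"
      unfolding miss_prob.simps
      using Suc.IH[OF 2] le1 p by (intro add_mono mult_left_mono) auto
    also have "\<dots> = 1 - (1 - p) * ?r ^ n" by (simp add: algebra_simps)
    also have "\<dots> \<le> 1 - ?r * ?r ^ n" using mult_right_mono[OF min.cobounded2 nn] by simp
    finally show ?thesis by simp
  qed
qed simp

text \<open>A form of the Markov property: what is in \<open>S\<close> after \<open>n\<close> steps
  stays there, and what is not is still in \<open>D\<close>, hence outside \<open>S\<close> after
  \<open>N\<close> more steps with probability at most \<open>c\<close>.\<close>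

lemma miss_prob_add:
  assumes p: "0 \<le> p" "p \<le> 1"
    and D: "f \<in> D \<rightarrow> D" "g \<in> D \<rightarrow> D" and S: "f \<in> S \<rightarrow> S" "g \<in> S \<rightarrow> S"
    and c: "\<And>y. y \<in> D \<Longrightarrow> miss_prob p f g S N y \<le> c" and "x \<in> D"
  shows "miss_prob p f g S (n + N) x \<le> c * miss_prob p f g S n x"
  using \<open>x \<in> D\<close>
proof (induction n arbitrary: x)
  case 0
  \<comment> \<open>For \<open>x\<close> in \<open>S\<close> both sides vanish by absorption;
    otherwise the indicator is \<open>1\<close> and the hypothesis on \<open>c\<close>
    applies.\<close>
  then show ?case
    using c[of x] miss_prob_absorbed[OF S, of x] by (cases "x \<in> S") auto
next
  case (Suc n)
  then have "f x \<in> D" "g x \<in> D" using D by auto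
  then have "p * miss_prob p f g S (n + N) (f x) + (1 - p) * miss_prob p f g S (n + N) (g x)
      \<le> p * (c * miss_prob p f g S n (f x)) + (1 - p) * (c * miss_prob p f g S n (g x))"
    using p by (intro add_mono mult_left_mono Suc.IH) auto
  then show ?case by (simp add: algebra_simps)
qed

text \<open>Time is cut into \<open>k\<close> blocks of \<open>N\<close> steps, each contributing a
  factor \<open>c\<close>.\<close>

lemma miss_prob_geometric:
  assumes p: "0 \<le> p" "p \<le> 1"
    and D: "f \<in> D \<rightarrow> D" "g \<in> D \<rightarrow> D" and S: "f \<in> S \<rightarrow> S" "g \<in> S \<rightarrow> S"
    and c: "\<And>y. y \<in> D \<Longrightarrow> miss_prob p f g S N y \<le> c" "0 \<le> c" and "x \<in> D"
  shows "miss_prob p f g S (k * N) x \<le> c ^ k"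
proof (induction k)
  case 0
  show ?case by (simp add: indicator_def)
next
  case (Suc k)
  have "miss_prob p f g S (k * N + N) x \<le> c * miss_prob p f g S (k * N) x"
    by (rule miss_prob_add[OF p D S c(1) \<open>x \<in> D\<close>])
  also have "\<dots> \<le> c * c ^ k" using Suc c(2) by (rule mult_left_mono)
  finally show ?case by (simp add: add.commute)
qed

section \<open>The random orbit on its probability space\<close>

locale iid_two_maps = prob_space M
  for M :: "'w measure" and H :: "nat \<Rightarrow> 'w \<Rightarrow> real \<Rightarrow> real" and f g :: "real \<Rightarrow> real" and p :: real +
  assumes iid: "iid_choices M H f g p" and neq: "f \<noteq> g"
begin

abbreviation X :: "real \<Rightarrow> nat \<Rightarrow> 'w \<Rightarrow> real" where
  "X \<equiv> random_orbit H"

lemma indep: "indep_vars (\<lambda>_. count_space {f, g}) H UNIV"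
  using iid by (simp add: iid_choices_def)

lemma H_cases: "\<omega> \<in> space M \<Longrightarrow> H n \<omega> = f \<or> H n \<omega> = g"
  using indep unfolding indep_vars_def by (auto dest!: measurable_space)

lemma choice_event: "h \<in> {f, g} \<Longrightarrow> {\<omega> \<in> space M. H n \<omega> = h} \<in> events"
proof -
  assume "h \<in> {f, g}"
  then have "H n -` {h} \<inter> space M \<in> events"
    using indep unfolding indep_vars_def by (intro measurable_sets[of _ _ "count_space {f, g}"]) auto
  also have "H n -` {h} \<inter> space M = {\<omega> \<in> space M. H n \<omega> = h}" by auto
  finally show ?thesis .
qed

lemma prob_choice:
  "prob {\<omega> \<in> space M. H n \<omega> = f} = p" "prob {\<omega> \<in> space M. H n \<omega> = g} = 1 - p"
  using iid by (auto simp: iid_choices_def)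

text \<open>Splitting by the last choice pulls \<open>S\<close> back along \<open>f\<close> or
  \<open>g\<close>. The position at time \<open>n\<close> depends on finitely many two-valued
  choices, so \<open>S\<close> may be any set, Borel or not.\<close>

lemma orbit_event: "{\<omega> \<in> space M. X x n \<omega> \<in> S} \<in> events"
proof (induction n arbitrary: S)
  case (Suc n)
  have "{\<omega> \<in> space M. X x (Suc n) \<omega> \<in> S} =
      ({\<omega> \<in> space M. H n \<omega> = f} \<inter> {\<omega> \<in> space M. X x n \<omega> \<in> f -` S}) \<union>
      ({\<omega> \<in> space M. H n \<omega> = g} \<inter> {\<omega> \<in> space M. X x n \<omega> \<in> g -` S})"
    using H_cases by fastforce
  then show ?case
    using choice_event[of f n] choice_event[of g n] Suc[of "f -` S"] Suc[of "g -` S"] by auto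
qed auto

text \<open>A cylinder event. Only the values of \<open>w\<close> below \<open>m\<close> matter, so
  a path is prolonged by updating \<open>w\<close> at \<open>m\<close>.\<close>

definition path :: "nat \<Rightarrow> (nat \<Rightarrow> real \<Rightarrow> real) \<Rightarrow> 'w set" where
  "path m w = {\<omega> \<in> space M. \<forall>i<m. H i \<omega> = w i}"

lemma path_Suc: "path (Suc m) (w(m := h)) = path m w \<inter> {\<omega> \<in> space M. H m \<omega> = h}"
  by (auto simp: path_def less_Suc_eq)

lemma path_event: "range w \<subseteq> {f, g} \<Longrightarrow> path m w \<in> events"
proof (induction m)
  case (Suc m)
  have "w m \<in> {f, g}" using Suc.prems by blast
  then show ?case using path_Suc[of m w "w m"] Suc choice_event[of "w m" m] by auto
qed (auto simp: path_def)

lemma prob_path: "range w \<subseteq> {f, g} \<Longrightarrow> prob (path m w) = (\<Prod>i<m. prob {\<omega> \<in> space M. H i \<omega> = w i})"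
\<comment> \<open>The product formula of independence concerns nonempty index sets, so the empty
  path is treated apart.\<close>
proof (cases "m = 0")
  case False
  assume w: "range w \<subseteq> {f, g}"
  have "prob (\<Inter>i\<in>{..<m}. H i -` {w i} \<inter> space M) = (\<Prod>i<m. prob (H i -` {w i} \<inter> space M))"
    using False w by (intro indep_varsD[OF indep]) auto
  moreover have "(\<Inter>i\<in>{..<m}. H i -` {w i} \<inter> space M) = path m w"
    using False by (auto simp: path_def)
  moreover have "H i -` {w i} \<inter> space M = {\<omega> \<in> space M. H i \<omega> = w i}" for i by auto
  ultimately show ?thesis by simp
qed (simp add: path_def prob_space)

lemma prob_path_Suc:
  assumes "range w \<subseteq> {f, g}" "h \<in> {f, g}"
  shows "prob (path (Suc m) (w(m := h))) = prob (path m w) * prob {\<omega> \<in> space M. H m \<omega> = h}"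
proof -
  have "range (w(m := h)) \<subseteq> {f, g}" using assms by auto
  then show ?thesis using prob_path[of "w(m := h)" "Suc m"] prob_path[OF assms(1), of m] by simp
qed

text \<open>
  Conditioning on the first \<open>m\<close> choices allows an induction on the number of remaining steps,
  which uses independence only through the product formula for paths.
\<close>

lemma prob_path_miss:
  assumes "range w \<subseteq> {f, g}" and "\<And>\<omega>. \<omega> \<in> path m w \<Longrightarrow> X x m \<omega> = y"
  shows "prob (path m w \<inter> {\<omega> \<in> space M. X x (m + n) \<omega> \<notin> S}) =
    prob (path m w) * miss_prob p f g S n y"
  using assms
proof (induction n arbitrary: m w y)
  case 0
  have "path m w \<inter> {\<omega> \<in> space M. X x (m + 0) \<omega> \<notin> S} = (if y \<in> S then {} else path m w)"
    using 0(2) by (auto simp: path_def)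
  then show ?case by simp
next
  case (Suc n)
  let ?E = "{\<omega> \<in> space M. X x (m + Suc n) \<omega> \<notin> S}"
  let ?P = "\<lambda>h. path (Suc m) (w(m := h))"
  have E: "?E \<in> events"
    using orbit_event[of x "m + Suc n" "- S"] by simp
  have step: "prob (?P h \<inter> ?E) =
      prob (path m w) * prob {\<omega> \<in> space M. H m \<omega> = h} * miss_prob p f g S n (h y)"
    if "h \<in> {f, g}" for h
  proof -
    have r: "range (w(m := h)) \<subseteq> {f, g}" using Suc.prems(1) that by auto
    have "X x (Suc m) \<omega> = h y" if "\<omega> \<in> ?P h" for \<omega>
      using that Suc.prems(2)[of \<omega>] unfolding path_Suc by simp
    from Suc.IH[OF r this] have "prob (?P h \<inter> ?E) = prob (?P h) * miss_prob p f g S n (h y)"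
      by (simp only: id_apply add_Suc add_Suc_right)
    then show ?thesis by (simp only: prob_path_Suc[OF Suc.prems(1) that])
  qed
  have ev: "?P h \<in> events" if "h \<in> {f, g}" for h
    using that Suc.prems(1) by (intro path_event) auto
  \<comment> \<open>The choice at time \<open>m\<close> splits the event in two; the parts are
    disjoint because \<open>f \<noteq> g\<close>.\<close>
  have "path m w \<inter> ?E = (?P f \<inter> ?E) \<union> (?P g \<inter> ?E)"
    using H_cases unfolding path_Suc by (auto simp: path_def)
  moreover have "(?P f \<inter> ?E) \<inter> (?P g \<inter> ?E) = {}"
    using neq unfolding path_Suc by auto
  ultimately have "prob (path m w \<inter> ?E) = prob (?P f \<inter> ?E) + prob (?P g \<inter> ?E)"
    using ev[of f] ev[of g] E by (simp add: finite_measure_Union)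
  also have "\<dots> = prob (path m w) * miss_prob p f g S (Suc n) y"
    using step[of f] step[of g] prob_choice[of m] by (simp add: algebra_simps)
  finally show ?case .
qed

lemma prob_miss: "prob {\<omega> \<in> space M. X x n \<omega> \<notin> S} = miss_prob p f g S n x"
proof -
  have "path 0 (\<lambda>_. f) = space M" by (simp add: path_def)
  moreover have "space M \<inter> {\<omega> \<in> space M. X x n \<omega> \<notin> S} = {\<omega> \<in> space M. X x n \<omega> \<notin> S}" by blast
  ultimately show ?thesis
    using prob_path_miss[of "\<lambda>_. f" 0 x x n S] by (simp add: prob_space)
qed

text \<open>From every point of \<open>D\<close> a block of \<open>N\<close> steps ends outside
  \<open>S\<close> with probability at most a fixed \<open>c < 1\<close>, so the probability of
  never hitting \<open>S\<close> is at most \<open>c ^ k\<close> for every \<open>k\<close>.\<close>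

lemma prob_hit:
  assumes p: "0 < p" "p < 1"
    and D: "f \<in> D \<rightarrow> D" "g \<in> D \<rightarrow> D" and S: "f \<in> S \<rightarrow> S" "g \<in> S \<rightarrow> S"
    and N: "D \<subseteq> reach f g S N" and x: "x \<in> D"
  shows "prob {\<omega> \<in> space M. \<exists>n. X x n \<omega> \<in> S} = 1"
proof -
  define c where "c = 1 - min p (1 - p) ^ N"
  have "min p (1 - p) ^ N \<le> 1" using p by (intro power_le_one) auto
  then have c: "0 \<le> c" "c < 1" using p by (auto simp: c_def)
  have "miss_prob p f g S N y \<le> c" if "y \<in> D" for y
    unfolding c_def using N that by (intro miss_prob_reach p) auto
  then have miss: "miss_prob p f g S (k * N) x \<le> c ^ k" for k
    using miss_prob_geometric[OF _ _ D S _ c(1) x] p by (simp add: less_imp_le)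
  let ?E = "{\<omega> \<in> space M. \<exists>n. X x n \<omega> \<in> S}"
  have "?E = (\<Union>n. {\<omega> \<in> space M. X x n \<omega> \<in> S})" by auto
  then have ev: "?E \<in> events" using orbit_event by auto
  have "1 - c ^ k \<le> prob ?E" for k
  proof -
    have ev': "{\<omega> \<in> space M. X x (k * N) \<omega> \<in> S} \<in> events" by (rule orbit_event)
    have "1 - c ^ k \<le> 1 - prob {\<omega> \<in> space M. X x (k * N) \<omega> \<notin> S}"
      using miss[of k] by (simp add: prob_miss)
    also have "\<dots> = prob {\<omega> \<in> space M. X x (k * N) \<omega> \<in> S}"
      using prob_neg[OF ev'] by simp
    also have "\<dots> \<le> prob ?E" using ev by (intro finite_measure_mono) auto
    finally show ?thesis .
  qed
  moreover have "(\<lambda>k. 1 - c ^ k) \<longlonglongrightarrow> 1 - 0"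
    using c by (intro tendsto_intros LIMSEQ_power_zero) auto
  ultimately have "1 \<le> prob ?E"
    using LIMSEQ_le_const2[of "\<lambda>k. 1 - c ^ k" 1 "prob ?E"] by auto
  then show ?thesis using prob_le_1[of ?E] by linarith
qed

end

section \<open>Unimodal Allee maps\<close>

lemma unimodal_allee_mapD:
  assumes "unimodal_allee_map b f A B K"
  shows "f \<in> {0..b} \<rightarrow> {0..b}" "continuous_on {0..b} f" "0 < A" "A < B" "B < K" "K \<le> b"
    "f 0 = 0" "f A = A" "f K = K"
    "\<And>x. 0 < x \<Longrightarrow> x < A \<Longrightarrow> f x < x" "\<And>x. K < x \<Longrightarrow> x \<le> b \<Longrightarrow> f x < x"
    "\<And>x. A < x \<Longrightarrow> x < K \<Longrightarrow> x < f x"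
proof -
  have fp: "{x \<in> {0..b}. f x = x} = {0, A, K}"
    using assms by (simp add: unimodal_allee_map_def allee_map_def)
  have "K \<in> {x \<in> {0..b}. f x = x}" "A \<in> {x \<in> {0..b}. f x = x}" "0 \<in> {x \<in> {0..b}. f x = x}"
    unfolding fp by auto
  then show "K \<le> b" "f 0 = 0" "f A = A" "f K = K" by auto
qed (use assms in \<open>auto simp: unimodal_allee_map_def allee_map_def\<close>)

text \<open>Monotonicity is given on open intervals only, so the comparison with the value at
  \<open>B\<close>, and then the one at \<open>b\<close>, follow by continuity on closures.\<close>

lemma unimodal_allee_map_le_max:
  assumes u: "unimodal_allee_map b f A B K" and x: "x \<in> {0..b}"
  shows "f x \<le> f B"
proof -
  note D = unimodal_allee_mapD[OF u]
  have inc: "strict_mono_on {0<..<B} f" and dec: "strict_antimono_on {B<..<b} f"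
    using u by (auto simp: unimodal_allee_map_def)
  have left: "f y \<le> f B" if "0 < y" "y < B" for y
  proof (rule continuous_ge_on_closure[where f = f])
    show "continuous_on (closure {y<..<B}) f"
      using that D by (auto intro!: continuous_on_subset[OF D(2)])
    show "B \<in> closure {y<..<B}" using that by simp
    show "f y \<le> f z" if "z \<in> {y<..<B}" for z
      using that \<open>0 < y\<close> by (intro less_imp_le strict_mono_onD[OF inc]) auto
  qed
  have right: "f y \<le> f B" if "B < y" "y < b" for y
  proof (rule continuous_ge_on_closure[where f = f])
    show "continuous_on (closure {B<..<y}) f"
      using that D by (auto intro!: continuous_on_subset[OF D(2)])
    show "B \<in> closure {B<..<y}" using that by simp
    show "f y \<le> f z" if "z \<in> {B<..<y}" for z
      using that \<open>y < b\<close> monotone_onD[OF dec, of z y] by auto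
  qed
  have "f b \<le> f B"
  proof (rule continuous_le_on_closure[where f = f])
    show "continuous_on (closure {B<..<b}) f"
      using D by (auto intro!: continuous_on_subset[OF D(2)])
    show "b \<in> closure {B<..<b}" using D by simp
  qed (use right in auto)
  \<comment> \<open>This settles \<open>x = 0\<close>, where \<open>f 0 = 0\<close>.\<close>
  moreover have "f B \<ge> 0" using D by (auto simp: Pi_iff)
  ultimately show ?thesis
    using x left[of x] right[of x] D(7) by (cases x B rule: linorder_cases; cases "x = 0"; cases "x = b") auto
qed

text \<open>
  Contraction gives \<open>f B - K < K - B\<close>, so no point of \<open>[B, f B]\<close> can be mapped below \<open>B\<close>.
\<close>

lemma contracting_hump:
  assumes u: "unimodal_allee_map b f A B K"
    and deriv: "\<And>x. x \<in> {B<..<f B} \<Longrightarrow> f differentiable (at x) \<and> \<bar>deriv f x\<bar> < 1"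
    and x: "x \<in> {B..f B}"
  shows "x \<noteq> K \<Longrightarrow> \<bar>f x - K\<bar> < \<bar>x - K\<bar>" and "f x \<in> {B..f B}"
proof -
  note D = unimodal_allee_mapD[OF u]
  have fB: "f B \<in> {0..b}" using D by (auto simp: Pi_iff)
  have KfB: "K \<le> f B" using unimodal_allee_map_le_max[OF u, of K] D by simp
  \<comment> \<open>The mean value theorem puts the intermediate point into the open interval where
    the derivative is bounded, so the inequality is strict even if \<open>s\<close> or
    \<open>t\<close> is an endpoint.\<close>
  have contr: "\<bar>f t - f s\<bar> < t - s" if "B \<le> s" "s < t" "t \<le> f B" for s t
  proof -
    have "\<exists>l z. z > s \<and> z < t \<and> (f has_real_derivative l) (at z) \<and> f t - f s = (t - s) * l"
    proof (rule MVT)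
      show "continuous_on {s..t} f"
        using that D fB by (auto intro!: continuous_on_subset[OF D(2)])
      show "f differentiable (at z)" if "s < z" "z < t" for z
        using that \<open>B \<le> s\<close> \<open>t \<le> f B\<close> deriv[of z] by auto
    qed (use that in auto)
    then obtain l z where z: "s < z" "z < t" "(f has_real_derivative l) (at z)"
      "f t - f s = (t - s) * l" by blast
    have "\<bar>l\<bar> < 1" using DERIV_imp_deriv[OF z(3)] deriv[of z] z that by auto
    then show ?thesis using z(4) that by (simp add: abs_mult)
  qed
  show closer: "x \<noteq> K \<Longrightarrow> \<bar>f x - K\<bar> < \<bar>x - K\<bar>"
    using contr[of x K] contr[of K x] x KfB D by (cases "x < K") auto
  have "f B - K < K - B" using contr[of B K] D KfB by auto
  then have "B \<le> f x" using closer x D by (cases "x = K") auto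
  moreover have "f x \<le> f B" using unimodal_allee_map_le_max[OF u, of x] x D fB by auto
  ultimately show "f x \<in> {B..f B}" by simp
qed

text \<open>A pathwise statement: from time \<open>m\<close> on the orbit decreases to some
  \<open>L < Ag\<close>, and passing to the limit gives \<open>L \<le> max (f L) (g L)\<close>,
  which fails for \<open>0 < L < Ag\<close>.\<close>

lemma allee_orbit_tendsto_0:
  assumes f: "unimodal_allee_map b f Af Bf Kf" and g: "unimodal_allee_map b g Ag Bg Kg"
    and A: "Ag \<le> Af" and H: "\<And>n. H n \<omega> = f \<or> H n \<omega> = g"
    and hit: "random_orbit H x m \<omega> \<in> {0..<Ag}"
  shows "(\<lambda>n. random_orbit H x n \<omega>) \<longlonglongrightarrow> 0"
proof -
  note Df = unimodal_allee_mapD[OF f] and Dg = unimodal_allee_mapD[OF g]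
  \<comment> \<open>The maximum is continuous and bounds the next position whichever map is drawn,
    so the order of the choices is irrelevant to the limit.\<close>
  let ?\<phi> = "\<lambda>y. max (f y) (g y)"
  define Y where "Y n = random_orbit H x (m + n) \<omega>" for n
  have le: "y \<in> {0..<Ag} \<Longrightarrow> 0 \<le> f y \<and> f y \<le> y \<and> 0 \<le> g y \<and> g y \<le> y" for y
    using Df Dg A by (cases "y = 0") (auto simp: Pi_iff intro: less_imp_le)
  have Y_Suc: "Y (Suc n) = f (Y n) \<or> Y (Suc n) = g (Y n)" for n
    using H[of "m + n"] by (auto simp: Y_def)
  have Y: "Y n \<in> {0..<Ag}" for n
  proof (induction n)
    case 0
    then show ?case using hit by (simp add: Y_def)
  next
    case (Suc n)
    then show ?case using le[OF Suc] Y_Suc[of n] by auto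
  qed
  have dec: "decseq Y"
    using le[OF Y] Y_Suc by (intro decseq_SucI) metis
  obtain L where L: "Y \<longlonglongrightarrow> L" "\<And>n. L \<le> Y n"
    using decseq_convergent[OF dec, of 0] Y by auto
  have "0 \<le> L" using L(1) Y by (intro LIMSEQ_le_const) auto
  have "L < Ag" using L(2)[of 0] Y[of 0] by auto
  have "continuous_on {0..b} ?\<phi>" by (intro continuous_intros Df Dg)
  moreover have "{0..<Ag} \<subseteq> {0..b}" using Dg by auto
  then have "L \<in> {0..b}" "\<forall>\<^sub>F n in sequentially. Y n \<in> {0..b}"
    using \<open>0 \<le> L\<close> \<open>L < Ag\<close> Y by (auto simp: subset_iff)
  ultimately have "(\<lambda>n. ?\<phi> (Y n)) \<longlonglongrightarrow> ?\<phi> L"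
    using L(1) by (intro continuous_on_tendsto_compose[of "{0..b}" ?\<phi> Y L sequentially])
  moreover have "Y (Suc n) \<le> ?\<phi> (Y n)" for n using Y_Suc[of n] by auto
  ultimately have "L \<le> ?\<phi> L"
    using L(1) by (intro LIMSEQ_le[OF LIMSEQ_Suc[OF L(1)]]) auto
  then have "L = 0"
    using \<open>0 \<le> L\<close> \<open>L < Ag\<close> A Df(10)[of L] Dg(10)[of L] by (cases "L = 0") auto
  then have "(\<lambda>n. random_orbit H x (n + m) \<omega>) \<longlonglongrightarrow> 0"
    using L(1) by (simp add: Y_def[abs_def] add.commute)
  then show ?thesis by (rule LIMSEQ_offset)
qed

text \<open>The set \<open>R\<close> contains every point that \<open>f\<close> or \<open>g\<close>
  sends into it, so it is enlarged in turn: \<open>[0, Af)\<close>, a neighbourhood of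
  \<open>Kf\<close>, \<open>[Bf, f Bf]\<close>, \<open>(Af, f Bf]\<close>, all points with
  \<open>f y \<noteq> Af\<close>, and finally \<open>Af\<close> with its preimages under
  \<open>f\<close>.\<close>

lemma allee_reach:
  assumes f: "unimodal_allee_map b f Af Bf Kf" and g: "unimodal_allee_map b g Ag Bg Kg"
    and A: "Ag < Af"
    and deriv: "\<And>x. x \<in> {Bf<..<f Bf} \<Longrightarrow> f differentiable (at x) \<and> \<bar>deriv f x\<bar> < 1"
    and hs: "set hs \<subseteq> {f, g}" "foldr (\<circ>) hs id Kf < Af"
    and fg: "f (g Af) \<noteq> Af"
  shows "{0..b} \<subseteq> (\<Union>n. reach f g {0..<Ag} n)"
proof -
  note Df = unimodal_allee_mapD[OF f] and Dg = unimodal_allee_mapD[OF g]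
  define R where "R = (\<Union>n. reach f g {0..<Ag} n)"
  have maps: "f y \<in> {0..b}" "g y \<in> {0..b}" if "y \<in> {0..b}" for y
    using Df(1) Dg(1) that by auto
  have fB: "f Bf \<in> {0..b}" using Df by (intro maps) auto
  have stepf: "f y \<in> R \<Longrightarrow> y \<in> R" and stepg: "g y \<in> R \<Longrightarrow> y \<in> R" for y
    using reach_step[of f f g y] reach_step[of g f g y] unfolding R_def by auto
  have base: "{0..<Ag} \<subseteq> R"
    using reach.simps(1)[of f g "{0..<Ag}"] unfolding R_def by blast
  have iter: "(f ^^ n) y \<in> R \<Longrightarrow> y \<in> R" for n y
    unfolding R_def by (rule reach_funpow)

  have below: "y \<in> R" if y: "0 \<le> y" "y < Af" for y
  proof (cases "y < Ag")
    case True
    then show ?thesis using base y by auto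
  next
    case False
    have C: "continuous_on {Ag..y} f"
      using y Df Dg by (auto intro!: continuous_on_subset[OF Df(2)])
    have lt: "f z < z" if "z \<in> {Ag..y}" for z using that y Dg(3) Df(10)[of z] by auto
    obtain n where n: "(f ^^ n) y \<in> {Ag..y}" "f ((f ^^ n) y) \<notin> {Ag..y}"
      using orbit_leaves_compact[of "{Ag..y}" y "\<lambda>z. z" f] False C lt by auto
    \<comment> \<open>The exit is downwards, since \<open>f\<close> lies below the diagonal on
      \<open>[Ag, y]\<close>.\<close>
    then have "f ((f ^^ n) y) \<in> {0..<Ag}"
      using lt[OF n(1)] maps(1)[of "(f ^^ n) y"] y Df Dg by auto
    then show ?thesis using base stepf iter by blast
  qed

  have K: "Kf \<in> R"
    unfolding R_def
  proof (rule reach_word[OF hs(1)], fold R_def)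
    have "foldr (\<circ>) hs id Kf \<in> {0..b}"
      using hs(1) maps Df by (induction hs) auto
    then show "foldr (\<circ>) hs id Kf \<in> R" using below hs(2) by auto
  qed
  \<comment> \<open>Each stage is relatively open, hence so is \<open>R\<close>; thus
    \<open>R\<close> contains a neighbourhood of \<open>Kf\<close>.\<close>
  have "openin (top_of_set {0..b}) ({0..b} \<inter> {0..<Ag})"
    by (auto simp: openin_open intro!: exI[of _ "{..<Ag}"])
  then have "openin (top_of_set {0..b}) ({0..b} \<inter> reach f g {0..<Ag} n)" for n
    using Df(1,2) Dg(1,2) by (intro openin_reach)
  then have "openin (top_of_set {0..b}) (\<Union>n. {0..b} \<inter> reach f g {0..<Ag} n)" by blast
  then have "openin (top_of_set {0..b}) ({0..b} \<inter> R)"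
    by (simp only: Int_UN_distrib R_def)
  moreover have "Kf \<in> {0..b} \<inter> R" using K Df by auto
  ultimately have "\<exists>e>0. ball Kf e \<inter> {0..b} \<subseteq> {0..b} \<inter> R"
    unfolding openin_contains_ball by blast
  then obtain e where e: "e > 0" "ball Kf e \<inter> {0..b} \<subseteq> R" by auto

  have hump: "y \<in> R" if y: "y \<in> {Bf..f Bf}" for y
  proof (cases "y \<in> ball Kf e")
    case True
    then show ?thesis using e(2) y Df fB by auto
  next
    case False
    \<comment> \<open>Removing the ball excludes \<open>Kf\<close>, the one point where the distance
      to \<open>Kf\<close> does not drop. As \<open>[Bf, f Bf]\<close> is invariant, leaving
      \<open>?C\<close> means entering the ball.\<close>
    let ?C = "{Bf..f Bf} - ball Kf e"
    note hump = contracting_hump[OF f deriv]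
    have cont: "continuous_on ?C f"
      using Df fB by (auto intro!: continuous_on_subset[OF Df(2)])
    obtain n where n: "(f ^^ n) y \<in> ?C" "f ((f ^^ n) y) \<notin> ?C"
    proof (rule orbit_leaves_compact[of ?C y "\<lambda>z. \<bar>z - Kf\<bar>" f])
      show "compact ?C" by (intro compact_diff) auto
      show "continuous_on ?C (\<lambda>z. \<bar>f z - Kf\<bar>)" by (intro continuous_intros cont)
      show "\<bar>f z - Kf\<bar> < \<bar>z - Kf\<bar>" if "z \<in> ?C" for z
        using hump(1)[of z] that e(1) by (cases "z = Kf") auto
    qed (use False y in \<open>auto intro!: continuous_intros\<close>)
    then have "f ((f ^^ n) y) \<in> {Bf..f Bf}" using hump(2)[of "(f ^^ n) y"] by blast
    then have "f ((f ^^ n) y) \<in> ball Kf e \<inter> {0..b}" using n(2) fB Df by auto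
    then show ?thesis using e(2) stepf iter by blast
  qed

  have above: "y \<in> R" if y: "Af < y" "y \<le> f Bf" for y
  proof (cases "y < Bf")
    case False
    then show ?thesis using hump y by auto
  next
    case True
    have C: "continuous_on {y..Bf} f"
      using y Df by (auto intro!: continuous_on_subset[OF Df(2)])
    have lt: "z < f z" if "z \<in> {y..Bf}" for z using that y Df(5) Df(12)[of z] by auto
    obtain n where n: "(f ^^ n) y \<in> {y..Bf}" "f ((f ^^ n) y) \<notin> {y..Bf}"
    proof (rule orbit_leaves_compact[of "{y..Bf}" y "\<lambda>z. - z" f])
      show "continuous_on {y..Bf} (\<lambda>z. - f z)" by (intro continuous_intros C)
    qed (use True lt in \<open>auto intro!: continuous_intros\<close>)
    have "f ((f ^^ n) y) \<le> f Bf"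
      using n(1) y Df by (intro unimodal_allee_map_le_max[OF f]) auto
    \<comment> \<open>The exit is upwards past \<open>Bf\<close>, and the maximum
      \<open>f Bf\<close> bounds the overshoot.\<close>
    then have "f ((f ^^ n) y) \<in> {Bf..f Bf}"
      using lt[OF n(1)] n by auto
    then show ?thesis using hump stepf iter by blast
  qed

  \<comment> \<open>One step of \<open>f\<close> brings every point, also one beyond
    \<open>f Bf\<close>, to at most \<open>f Bf\<close>.\<close>
  have after_f: "y \<in> R" if y: "y \<in> {0..b}" "f y \<noteq> Af" for y
  proof (rule stepf)
    show "f y \<in> R"
      using below[of "f y"] above[of "f y"] maps(1)[OF y(1)] unimodal_allee_map_le_max[OF f y(1)] y(2)
      by (cases "f y" Af rule: linorder_cases) auto
  qed
  have threshold: "Af \<in> R"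
  proof (rule stepg)
    show "g Af \<in> R" using fg maps(2)[of Af] Df by (intro after_f) auto
  qed
  \<comment> \<open>Points with \<open>f y = Af\<close> remain; they reach \<open>R\<close> through
    \<open>Af\<close>.\<close>
  show ?thesis
    unfolding R_def[symmetric] using after_f threshold stepf by (metis subsetI)
qed

section \<open>Almost sure convergence to \<open>0\<close>\<close>

theorem theorem4:
  fixes f g :: "real \<Rightarrow> real"
    and b p Af Bf Kf Mf Ag Bg Kg Mg :: real
    and M :: "'w measure"
    and H :: "nat \<Rightarrow> 'w \<Rightarrow> real \<Rightarrow> real"
  assumes f: "unimodal_allee_map b f Af Bf Kf" and Mf: "Mf = f Bf"
    and g: "unimodal_allee_map b g Ag Bg Kg" and Mg: "Mg = g Bg"
    and b: "b = max Mf Mg"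
    and p: "0 < p" "p < 1"
    and M: "prob_space M"
    and H: "iid_choices M H f g p"
    and A: "Ag < Af"
    and deriv: "\<forall>x \<in> {Bf<..<Mf}. f differentiable (at x) \<and> \<bar>deriv f x\<bar> < 1"
    and word: "\<exists>hs. hs \<noteq> [] \<and> set hs \<subseteq> {f, g} \<and> foldr (\<circ>) hs id Kf < Af"
    and fg: "f (g Af) \<noteq> Af"
  shows "\<forall>x0 \<in> {0..b}.
    measure M {\<omega> \<in> space M. (\<lambda>n. random_orbit H x0 n \<omega>) \<longlonglongrightarrow> 0} = 1"
proof
  fix x assume x: "x \<in> {0..b}"
  note Df = unimodal_allee_mapD[OF f] and Dg = unimodal_allee_mapD[OF g]
  let ?S = "{0..<Ag}"
  \<comment> \<open>The maps differ at \<open>Ag\<close>, which \<open>g\<close> fixes and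
    \<open>f\<close> lowers.\<close>
  have "f \<noteq> g" using Df(10)[of Ag] Dg(3,8) A by auto
  then interpret iid_two_maps M H f g p
    using M H by (simp add: iid_two_maps_def iid_two_maps_axioms_def)
  have S: "f \<in> ?S \<rightarrow> ?S" "g \<in> ?S \<rightarrow> ?S"
  proof -
    have "f y \<in> ?S \<and> g y \<in> ?S" if "y \<in> ?S" for y
      using that A Df(1,4,5,6,7) Dg(3,1,7) Df(10)[of y] Dg(10)[of y]
      by (cases "y = 0") (auto simp: Pi_iff)
    then show "f \<in> ?S \<rightarrow> ?S" "g \<in> ?S \<rightarrow> ?S" by auto
  qed
  have reach: "{0..b} \<subseteq> (\<Union>n. reach f g ?S n)"
  proof -
    obtain hs where "set hs \<subseteq> {f, g}" "foldr (\<circ>) hs id Kf < Af" using word by blast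
    then show ?thesis using deriv Mf fg by (intro allee_reach[OF f g A]) auto
  qed
  have "openin (top_of_set {0..b}) ({0..b} \<inter> ?S)"
    by (auto simp: openin_open intro!: exI[of _ "{..<Ag}"])
  then obtain N where N: "{0..b} \<subseteq> reach f g ?S N"
    using uniform_reach[OF compact_Icc Df(2,1) Dg(2,1) _ S(1) reach] by blast
  \<comment> \<open>Convergence to \<open>0\<close> is the same as hitting \<open>[0, Ag)\<close>,
    outcome by outcome, so the two events coincide.\<close>
  have "(\<lambda>n. X x n \<omega>) \<longlonglongrightarrow> 0 \<longleftrightarrow> (\<exists>n. X x n \<omega> \<in> ?S)" if \<omega>: "\<omega> \<in> space M" for \<omega>
  proof
    assume "(\<lambda>n. X x n \<omega>) \<longlonglongrightarrow> 0"
    then have "\<forall>\<^sub>F n in sequentially. X x n \<omega> < Ag"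
      using Dg(3) by (rule order_tendstoD)
    then obtain n where "X x n \<omega> < Ag" by (auto simp: eventually_sequentially)
    moreover have "X x n \<omega> \<in> {0..b}"
    proof (induction n)
      case (Suc n)
      then show ?case using H_cases[OF \<omega>, of n] Df(1) Dg(1) by auto
    qed (use x in simp)
    ultimately show "\<exists>n. X x n \<omega> \<in> ?S" by auto
  next
    assume "\<exists>n. X x n \<omega> \<in> ?S"
    then obtain n where "X x n \<omega> \<in> ?S" ..
    then show "(\<lambda>n. X x n \<omega>) \<longlonglongrightarrow> 0"
      by (rule allee_orbit_tendsto_0[OF f g less_imp_le[OF A], where H = H, OF H_cases[OF \<omega>]])
  qed
  then have "{\<omega> \<in> space M. (\<lambda>n. X x n \<omega>) \<longlonglongrightarrow> 0} = {\<omega> \<in> space M. \<exists>n. X x n \<omega> \<in> ?S}"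
    by blast
  then show "prob {\<omega> \<in> space M. (\<lambda>n. X x n \<omega>) \<longlonglongrightarrow> 0} = 1"
    using prob_hit[OF p Df(1) Dg(1) S N x] by simp
qed

end
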